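(* Let $\mathcal F:\mathscr P(\Theta)\to\mathbb R$ be $\lambda$-relative strongly convex on $\mathscr P(\Theta)$ with $\lambda=0$ (i.e. $L_2$-convex), and let $\rho^\ast\in\mathscr P(\Theta)$ be a global minimizer of $\mathcal F$ over $\mathscr P(\Theta)$ (not necessarily admitting a density). Assume there exists a constant $L>0$ such that $$|\mathcal F(\rho)-\mathcal F(\rho^\ast)|\le L\,W_1(\rho,\rho^\ast)\qquad\text{for all }\rho\in\mathscr P(\Theta).$$ Let $\rho_0\in\mathscr P^r(\Theta)$, let $\tau_k>0$ $(k\ge1)$ be step sizes, and suppose that for each $k\ge1$ a solution $$\rho_k\in\operatorname*{arg\,min}_{\rho\in\mathscr P(\Theta)}\ \mathcal F(\rho)+\frac1{\tau_k}D_{\mathrm{KL}}(\rho\,\|\,\rho_{k-1})$$ exists. Then for every $k\ge1$ and any $\rho\in\mathscr P^r(\Theta)$, $$\min_{1\le\ell\le k}\mathcal F(\rho_\ell)-\mathcal F(\rho^\ast)\le\frac{D_{\mathrm{KL}}(\rho\,\|\,\rho_0)}{\sum_{\ell=1}^k\tau_\ell}+L\,W_1(\rho,\rho^\ast).$$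
   Context: $\Theta\subset\mathbb R^d$; $\mathscr P(\Theta)$ is the set of probability distributions on $\Theta$ and $\mathscr P^r(\Theta)$ the subset of those admitting a density with respect to Lebesgue measure. $D_{\mathrm{KL}}(\rho\,\|\,\rho')$ is the Kullback-Leibler divergence ($+\infty$ if $\rho\not\ll\rho'$). $W_1(\rho,\rho')=\inf_{\gamma}\int_{\Theta\times\Theta}\|\theta-\theta'\|\,\mathrm d\gamma(\theta,\theta')$ is the $1$-Wasserstein distance, the infimum being over couplings $\gamma$ of $\rho$ and $\rho'$. $\mathcal F:\mathscr P(\Theta)\to\mathbb R$ is lower semi-continuous. A measure $\rho\in\mathscr P(\Theta)$ is regular for $\mathcal F$ if $\mathcal F(\varepsilon\rho+(1-\varepsilon)\rho')<\infty$ for all $\varepsilon\in(0,1)$ and all $\rho'\in\mathscr P^r(\Theta)$ with compact support and bounded density. For regular $\rho$, the first variation of $\mathcal F$ at $\rho$ is a map $\frac{\delta\mathcal F}{\delta\rho}(\rho):\Theta\to\mathbb R$ (unique up to an additive constant, assumed to exist) such that $\frac{\mathrm d}{\mathrm d\varepsilon}\mathcal F(\rho+\varepsilon\chi)\big|_{\varepsilon=0}=\int_\Theta\frac{\delta\mathcal F}{\delta\rho}(\rho)\,\mathrm d\chi$ for any perturbation $\chi=\rho'-\rho$ with such $\rho'$. $\mathcal F$ is ($L_2$-)convex, i.e. $0$-relative strongly convex, if for any pair of regular probability measures $\rho,\rho'\in\mathscr P(\Theta)$ such that $\mathcal F(\rho)$ is finite, $$\mathcal F(\rho')\ge\mathcal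 F(\rho)+\int\frac{\delta\mathcal F}{\delta\rho}(\rho)\,\mathrm d(\rho'-\rho).$$ *)

theory Defs
  imports "HOL-Probability.Probability"
begin

abbreviation prob_on :: "'a::euclidean_space set \<Rightarrow> 'a measure set" where
  "prob_on \<Theta> \<equiv> space (prob_algebra (restrict_space borel \<Theta>))"

definition has_lebesgue_density ::
    "'a::euclidean_space set \<Rightarrow> 'a measure \<Rightarrow> ('a \<Rightarrow> ennreal) \<Rightarrow> bool" where
  "has_lebesgue_density \<Theta> \<rho> g \<longleftrightarrow>
     g \<in> borel_measurable (restrict_space lborel \<Theta>) \<and> \<rho> = density (restrict_space lborel \<Theta>) g"

definition prob_dens_on :: "'a::euclidean_space set \<Rightarrow> 'a measure set" where
  "prob_dens_on \<Theta> = {\<rho> \<in> prob_on \<Theta>. \<exists>g. has_lebesgue_density \<Theta> \<rho> g}"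

definition measure_support :: "'a::topological_space measure \<Rightarrow> 'a set" where
  "measure_support \<rho> =
     {x \<in> space \<rho>. \<forall>U. open U \<longrightarrow> x \<in> U \<longrightarrow> emeasure \<rho> (U \<inter> space \<rho>) > 0}"

definition test_on :: "'a::euclidean_space set \<Rightarrow> 'a measure set" where
  "test_on \<Theta> = {\<rho> \<in> prob_on \<Theta>. compact (measure_support \<rho>) \<and>
     (\<exists>g C. has_lebesgue_density \<Theta> \<rho> g \<and> (\<forall>x\<in>\<Theta>. g x \<le> ennreal C))}"

(* \<epsilon> \<mu> + (1 - \<epsilon>) \<nu>, for measures on the same space *)
definition mix :: "real \<Rightarrow> 'a measure \<Rightarrow> 'a measure \<Rightarrow> 'a measure" where
  "mix \<epsilon> \<mu> \<nu> = measure_of (space \<mu>) (sets \<mu>)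
     (\<lambda>A. ennreal \<epsilon> * emeasure \<mu> A + ennreal (1 - \<epsilon>) * emeasure \<nu> A)"

lemma space_mix [simp]: "space (mix \<epsilon> \<mu> \<nu>) = space \<mu>"
  by (simp add: mix_def)

lemma sets_mix [simp, measurable_cong]: "sets (mix \<epsilon> \<mu> \<nu>) = sets \<mu>"
  by (simp add: mix_def)

lemma emeasure_mix:
  assumes "sets \<mu> = sets \<nu>" and "A \<in> sets \<mu>"
  shows "emeasure (mix \<epsilon> \<mu> \<nu>) A = ennreal \<epsilon> * emeasure \<mu> A + ennreal (1 - \<epsilon>) * emeasure \<nu> A"
  unfolding mix_def
proof (rule emeasure_measure_of_sigma)
  show "sigma_algebra (space \<mu>) (sets \<mu>)" by (rule sets.sigma_algebra_axioms)
  show "A \<in> sets \<mu>" by (rule assms(2))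
  show "countably_additive (sets \<mu>)
      (\<lambda>A. ennreal \<epsilon> * emeasure \<mu> A + ennreal (1 - \<epsilon>) * emeasure \<nu> A)"
  proof (rule countably_additiveI)
    fix B :: "nat \<Rightarrow> 'a set"
    assume B: "range B \<subseteq> sets \<mu>" "disjoint_family B"
    then have "range B \<subseteq> sets \<nu>" using assms(1) by simp
    then show "(\<Sum>i. ennreal \<epsilon> * emeasure \<mu> (B i) + ennreal (1 - \<epsilon>) * emeasure \<nu> (B i)) =
        ennreal \<epsilon> * emeasure \<mu> (\<Union>i. B i) + ennreal (1 - \<epsilon>) * emeasure \<nu> (\<Union>i. B i)"
      using B by (simp add: suminf_add[symmetric] ennreal_suminf_cmult suminf_emeasure)
  qed
qed (simp add: positive_def)

lemma mix_in_prob_on: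
  assumes "\<mu> \<in> prob_on \<Theta>" "\<nu> \<in> prob_on \<Theta>" "0 \<le> \<epsilon>" "\<epsilon> \<le> 1"
  shows "mix \<epsilon> \<mu> \<nu> \<in> prob_on \<Theta>"
proof -
  have s: "sets \<mu> = sets \<nu>" and p: "prob_space \<mu>" "prob_space \<nu>"
    using assms by (auto simp: space_prob_algebra)
  have sp: "space \<mu> = space \<nu>" using s by (rule sets_eq_imp_space_eq)
  have "emeasure (mix \<epsilon> \<mu> \<nu>) (space \<mu>) = ennreal \<epsilon> + ennreal (1 - \<epsilon>)"
    using emeasure_mix[OF s sets.top, of \<epsilon>] p
    by (simp add: prob_space.emeasure_space_1 flip: sp)
       (metis mult_1_right prob_space.emeasure_space_1 sp)
  also have "\<dots> = 1" using assms(3,4) by (simp flip: ennreal_plus)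
  finally show ?thesis
    using assms(1) by (auto simp: space_prob_algebra intro!: prob_spaceI)
qed

lemma mix_0: "sets \<mu> = sets \<nu> \<Longrightarrow> mix 0 \<mu> \<nu> = \<nu>"
  by (rule measure_eqI) (auto simp: emeasure_mix)

(* The negative part of the log-density ln (d\<rho>/d\<pi>) is always \<rho>-integrable for probability
   measures, so failure of integrability means that the integral diverges to \<infinity>. *)
definition kl_div :: "'a measure \<Rightarrow> 'a measure \<Rightarrow> ereal" where
  "kl_div \<rho> \<pi> =
     (if absolutely_continuous \<pi> \<rho> \<and> integrable \<rho> (entropy_density (exp 1) \<pi> \<rho>)
      then ereal (KL_divergence (exp 1) \<pi> \<rho>) else \<infinity>)"

definition couplings :: "'a measure \<Rightarrow> 'a measure \<Rightarrow> ('a \<times> 'a) measure set" where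
  "couplings \<rho> \<rho>' = {\<gamma>. sets \<gamma> = sets (\<rho> \<Otimes>\<^sub>M \<rho>') \<and> distr \<gamma> \<rho> fst = \<rho> \<and> distr \<gamma> \<rho>' snd = \<rho>'}"

definition W1 :: "'a::euclidean_space measure \<Rightarrow> 'a measure \<Rightarrow> ennreal" where
  "W1 \<rho> \<rho>' = (INF \<gamma>\<in>couplings \<rho> \<rho>'. \<integral>\<^sup>+ (x, y). ennreal (norm (x - y)) \<partial>\<gamma>)"

(* The topology of weak convergence of probability measures (tested against bounded continuous
   functions on \<Theta>). *)
definition narrow_topology :: "'a::euclidean_space set \<Rightarrow> 'a measure topology" where
  "narrow_topology \<Theta> = topology_generated_by
     {{\<rho> \<in> prob_on \<Theta>. (\<integral>x. f x \<partial>\<rho>) \<in> U} | f U.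
        continuous_on \<Theta> f \<and> bounded (f ` \<Theta>) \<and> open (U :: real set)}"

definition lsc_on :: "'a::euclidean_space set \<Rightarrow> ('a measure \<Rightarrow> real) \<Rightarrow> bool" where
  "lsc_on \<Theta> F \<longleftrightarrow> (\<forall>c. openin (narrow_topology \<Theta>) {\<rho> \<in> prob_on \<Theta>. c < F \<rho>})"

(* The finiteness conditions here and in L2_convex_on are those of the theory for functionals
   with values in the extended reals; they hold automatically for a real-valued F. *)
definition regular_for ::
    "'a::euclidean_space set \<Rightarrow> ('a measure \<Rightarrow> real) \<Rightarrow> 'a measure \<Rightarrow> bool" where
  "regular_for \<Theta> F \<rho> \<longleftrightarrow> \<rho> \<in> prob_on \<Theta> \<and>
     (\<forall>\<epsilon>\<in>{0<..<1}. \<forall>\<rho>'\<in>test_on \<Theta>. ereal (F (mix \<epsilon> \<rho> \<rho>')) < \<infinity>)"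

(* With \<chi> = \<rho>' - \<rho> one has \<rho> + \<epsilon> \<chi> = \<epsilon> \<rho>' + (1 - \<epsilon>) \<rho>, which is a probability measure for
   \<epsilon> in [0,1]; so the derivative at 0 is one-sided.  Integrability against every signed measure
   \<chi> amounts to integrability against \<rho> and against every test measure \<rho>'. *)
definition is_first_variation ::
    "'a::euclidean_space set \<Rightarrow> ('a measure \<Rightarrow> real) \<Rightarrow> 'a measure \<Rightarrow> ('a \<Rightarrow> real) \<Rightarrow> bool" where
  "is_first_variation \<Theta> F \<rho> \<phi> \<longleftrightarrow> integrable \<rho> \<phi> \<and>
     (\<forall>\<rho>'\<in>test_on \<Theta>. integrable \<rho>' \<phi> \<and>
        ((\<lambda>\<epsilon>. F (mix \<epsilon> \<rho>' \<rho>)) has_real_derivative ((\<integral>x. \<phi> x \<partial>\<rho>') - (\<integral>x. \<phi> x \<partial>\<rho>)))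
          (at 0 within {0..1}))"

(* dF \<rho> plays the role of the first variation of F at \<rho>.  It is \<rho>-integrable, but for a general
   \<rho>' its \<rho>'-integral need not exist; the inequality is required whenever it does. *)
definition L2_convex_on ::
    "'a::euclidean_space set \<Rightarrow> ('a measure \<Rightarrow> real) \<Rightarrow> ('a measure \<Rightarrow> 'a \<Rightarrow> real) \<Rightarrow> bool" where
  "L2_convex_on \<Theta> F dF \<longleftrightarrow>
     (\<forall>\<rho> \<rho>'. regular_for \<Theta> F \<rho> \<and> regular_for \<Theta> F \<rho>' \<and> \<bar>ereal (F \<rho>)\<bar> \<noteq> \<infinity> \<and>
        integrable \<rho>' (dF \<rho>) \<longrightarrow>
        F \<rho>' \<ge> F \<rho> + ((\<integral>x. dF \<rho> x \<partial>\<rho>') - (\<integral>x. dF \<rho> x \<partial>\<rho>)))"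

end

theory Submission
  imports Defs
begin

text \<open>
  One step of the scheme is a proximal step for the Kullback-Leibler divergence, and the rate is the
  usual one for mirror descent with exact (implicit) steps: the optimality of \<open>\<rho>\<^sub>j\<close> gives
  \<open>\<tau>\<^sub>j (F \<rho>\<^sub>j - F \<rho>) \<le> KL(\<rho> | \<rho>\<^sub>j\<^sub>-\<^sub>1) - KL(\<rho> | \<rho>\<^sub>j)\<close>, the right-hand sides telescope, and the
  smallest of the values \<open>F \<rho>\<^sub>j\<close> is at most their average with weights \<open>\<tau>\<^sub>j\<close>. The Lipschitz bound in the
  distance \<open>W1\<close> enters only at the end, to pass from \<open>F \<rho>\<close> to \<open>F \<rho>star\<close>. It is this comparison
  with an auxiliary \<open>\<rho>\<close> that makes the bound useful when \<open>\<rho>star\<close> has no density and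
  \<open>KL(\<rho>star | \<rho>\<^sub>0)\<close> is infinite.

  The textbook derivation of the one-step inequality writes the first-order condition
  \<open>dF(\<rho>\<^sub>j) + ln(d\<rho>\<^sub>j/d\<rho>\<^sub>j\<^sub>-\<^sub>1)/\<tau>\<^sub>j = const\<close> and integrates it against \<open>\<rho> - \<rho>\<^sub>j\<close>, which raises the
  question whether the first variation at \<open>\<rho>\<^sub>j\<close> is \<open>\<rho>\<close>-integrable. The proof here differentiates
  nothing. It has two ingredients.

  First, \<open>F\<close> is convex along the segment from \<open>\<nu>\<close> to \<open>\<mu>\<close>, for arbitrary probability measures
  (\<open>L2_convex_imp_convex_mix\<close>). The gradient inequality is applied at an interior point \<open>\<kappa>\<close> of the
  segment, where integrability is free of charge: \<open>dF \<kappa>\<close> is \<open>\<kappa>\<close>-integrable, and both end points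
  are dominated by a multiple of \<open>\<kappa>\<close>.

  Second, if \<open>q\<close> is such that \<open>KL( \<cdot> | \<pi>)\<close> grows at least linearly, with slope \<open>c\<close>, on the way from \<open>q\<close>
  towards \<open>\<rho>\<close>, then \<open>KL(\<rho> | q) + KL(q | \<pi>) + c \<le> KL(\<rho> | \<pi>)\<close> (\<open>kl_div_three_point\<close>). With
  \<open>\<mu>\<^sub>e = e \<rho> + (1 - e) q\<close> the compensation identity gives
  \<open>e KL(\<rho> | \<mu>\<^sub>e) \<le> e KL(\<rho> | \<pi>) + (1 - e) KL(q | \<pi>) - KL(\<mu>\<^sub>e | \<pi>)\<close>; dividing by \<open>e\<close> and letting \<open>e\<close> tend
  to \<open>0\<close> yields the claim by Fatou's lemma, which also shows that \<open>\<rho>\<close> is absolutely continuous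
  with respect to \<open>q\<close>. Minimality of \<open>\<rho>\<^sub>j\<close> together with convexity of \<open>F\<close> supplies the linear growth,
  with \<open>c = \<tau>\<^sub>j (F \<rho>\<^sub>j - F \<rho>)\<close> (\<open>proximal_step\<close>).
\<close>

section \<open>The integrand of the Kullback-Leibler divergence\<close>

text \<open>
  The Bregman divergence of \<open>x ln x\<close>. Compared with \<open>a ln (a/b)\<close>, the added \<open>b - a\<close> integrates to
  zero for probability densities and makes the integrand nonnegative, as Fatou's lemma needs.
\<close>

definition kl_bregman :: "real \<Rightarrow> real \<Rightarrow> real" where
  "kl_bregman a b = a * ln (a / b) + b - a"

text \<open>
  The side condition cannot be dropped: division by zero and \<open>ln 0\<close> are both \<open>0\<close>, so
  \<open>kl_bregman a 0 = - a\<close>, whereas the value relevant for the divergence is \<open>\<infinity>\<close>.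
\<close>
lemma kl_bregman_nonneg:
  assumes "0 \<le> a" "0 \<le> b" "b = 0 \<Longrightarrow> a = 0"
  shows "0 \<le> kl_bregman a b"
proof (cases "a = 0")
  case True
  then show ?thesis using assms by (simp add: kl_bregman_def)
next
  case False
  then have ab: "0 < a" "0 < b" using assms by (auto simp: less_le)
  have "ln (b / a) \<le> b / a - 1"
    using ab by (intro ln_le_minus_one) simp
  then have "a * ln (b / a) \<le> a * (b / a - 1)"
    using ab by (intro mult_left_mono) auto
  also have "\<dots> = b - a"
    using ab by (simp add: field_simps)
  finally show ?thesis
    using ab by (simp add: kl_bregman_def ln_div algebra_simps)
qed

text \<open>
  The pointwise form of the compensation identity: the excess of the convex function \<open>x ln x\<close> over
  the chord equals \<open>e kl_bregman a m + (1 - e) kl_bregman b m\<close>, and the second term is dropped. In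
  particular it contains the convexity of \<open>x ln x\<close>.
\<close>
lemma kl_bregman_mixture_le:
  assumes "0 \<le> a" "0 \<le> b" "0 < e" "e < 1"
  defines "m \<equiv> e * a + (1 - e) * b"
  shows "e * kl_bregman a m \<le> e * (a * ln a) + (1 - e) * (b * ln b) - m * ln m"
proof -
  have m0: "0 \<le> m" using assms by simp
  have ma: "m = 0 \<Longrightarrow> a = 0" and mb: "m = 0 \<Longrightarrow> b = 0"
    using assms by (auto simp: add_nonneg_eq_0_iff)
  have split: "kl_bregman x m = x * ln x - x * ln m + m - x" if "m = 0 \<longrightarrow> x = 0" for x
    using that by (cases "x = 0") (auto simp: kl_bregman_def ln_div algebra_simps)
  have "kl_bregman a m = a * ln a - a * ln m + m - a" "kl_bregman b m = b * ln b - b * ln m + m - b"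
    using split ma mb by blast+
  note split = this
  have "e * kl_bregman a m + (1 - e) * kl_bregman b m =
      e * (a * ln a) + (1 - e) * (b * ln b) - (e * a + (1 - e) * b) * ln m
        + (m - (e * a + (1 - e) * b))"
    unfolding split by (simp add: algebra_simps)
  also have "\<dots> = e * (a * ln a) + (1 - e) * (b * ln b) - m * ln m"
    by (simp add: m_def)
  finally have "e * kl_bregman a m + (1 - e) * kl_bregman b m = \<dots>" .
  moreover have "0 \<le> (1 - e) * kl_bregman b m"
    using kl_bregman_nonneg[of b m] assms(2,4) m0 mb by simp
  ultimately show ?thesis by linarith
qed

text \<open>
  The value \<open>\<infinity>\<close> where the second density vanishes and the first does not is what later forces
  absolute continuity: an integrable limit cannot be infinite on a set of positive measure.
\<close>
lemma kl_bregman_mixture_tendsto: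
  fixes e :: "nat \<Rightarrow> real"
  assumes a: "0 \<le> a" and b: "0 \<le> b" and e0: "e \<longlonglongrightarrow> 0" and epos: "\<And>n. 0 < e n"
  shows "(\<lambda>n. ennreal (kl_bregman a (e n * a + (1 - e n) * b)))
           \<longlonglongrightarrow> (if a \<noteq> 0 \<and> b = 0 then \<infinity> else ennreal (kl_bregman a b))"
proof (cases "a \<noteq> 0 \<and> b = 0")
  case True
  then have "0 < a" using a by simp
  have *: "kl_bregman a (e n * a + (1 - e n) * b) = e n * a - a - a * ln (e n)" for n
    using True \<open>0 < a\<close> epos[of n] by (simp add: kl_bregman_def ln_div algebra_simps)
  have "filterlim e (at_right 0) sequentially"
    using e0 epos by (auto simp: filterlim_at less_imp_neq[symmetric])
  then have "filterlim (\<lambda>n. ln (e n)) at_bot sequentially"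
    by (rule filterlim_compose[OF ln_at_0])
  then have "filterlim (\<lambda>n. - a * ln (e n)) at_top sequentially"
    using \<open>0 < a\<close> by (subst filterlim_tendsto_neg_mult_at_top_iff[OF tendsto_const]) auto
  then have "filterlim (\<lambda>n. (e n * a - a) + - a * ln (e n)) at_top sequentially"
    by (rule filterlim_tendsto_add_at_top
        [OF tendsto_diff[OF tendsto_mult_left_zero[OF e0] tendsto_const]])
  then have "filterlim (\<lambda>n. kl_bregman a (e n * a + (1 - e n) * b)) at_top sequentially"
    by (simp add: *)
  then have "((\<lambda>n. ennreal (kl_bregman a (e n * a + (1 - e n) * b))) \<longlongrightarrow> top) sequentially"
    by (simp only: ennreal_tendsto_top_eq_at_top)
  then show ?thesis using True by simp
next
  case False
  have m: "(\<lambda>n. e n * a + (1 - e n) * b) \<longlonglongrightarrow> 0 * a + (1 - 0) * b"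
    by (intro tendsto_intros e0)
  have "(\<lambda>n. kl_bregman a (e n * a + (1 - e n) * b)) \<longlonglongrightarrow> kl_bregman a b"
  proof (cases "a = 0")
    case True
    then show ?thesis using m by (simp add: kl_bregman_def)
  next
    case a: False
    then have "b \<noteq> 0" "a \<noteq> 0" using False by auto
    then show ?thesis
      unfolding kl_bregman_def using m by (intro tendsto_intros) auto
  qed
  then have "(\<lambda>n. ennreal (kl_bregman a (e n * a + (1 - e n) * b))) \<longlonglongrightarrow> ennreal (kl_bregman a b)"
    by (rule tendsto_ennrealI)
  then show ?thesis unfolding if_not_P[OF False] .
qed

section \<open>The divergence in terms of densities\<close>

text \<open>
  Taking the reference measure of the divergence itself as a density makes it possible to compare
  \<open>KL(\<rho> | \<pi>)\<close>, \<open>KL(q | \<pi>)\<close> and \<open>KL(\<rho> | q)\<close> as integrals over the single measure \<open>\<pi>\<close>.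
\<close>
lemma kl_div_density_density:
  fixes f g :: "'a \<Rightarrow> real"
  assumes M: "sigma_finite_measure M"
    and f[measurable]: "f \<in> borel_measurable M" and f0: "\<And>x. 0 \<le> f x"
    and g[measurable]: "g \<in> borel_measurable M" and g0: "\<And>x. 0 \<le> g x"
    and ac: "AE x in M. f x = 0 \<longrightarrow> g x = 0"
  shows "kl_div (density M g) (density M f) =
     (if integrable M (\<lambda>x. g x * ln (g x / f x)) then ereal (\<integral>x. g x * ln (g x / f x) \<partial>M) else \<infinity>)"
proof -
  interpret sigma_finite_measure M by fact
  interpret Mf: sigma_finite_measure "density M f"
    using f0 by (subst sigma_finite_iff_density_finite) auto
  let ?E = "entropy_density (exp 1) (density M f) (density M g)"
  have dd: "density (density M f) (\<lambda>x. g x / f x) = density M g"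
    using f0 g0 ac by (subst density_density_divide) simp_all
  have ac': "absolutely_continuous (density M f) (density M g)"
    using absolutely_continuousI_density[of "\<lambda>x. ennreal (g x / f x)" "density M f"] dd by simp
  have [measurable]: "?E \<in> borel_measurable M"
    using measurable_entropy_density[of "exp 1" "density M f" "density M g"] by simp
  have "AE x in density M f. ennreal (g x / f x) = RN_deriv (density M f) (density M g) x"
    by (rule Mf.RN_deriv_unique[OF _ dd]) simp
  then have "AE x in M. 0 < f x \<longrightarrow> ennreal (g x / f x) = RN_deriv (density M f) (density M g) x"
    by (simp add: AE_density)
  with ac have E: "AE x in M. g x * ?E x = g x * ln (g x / f x)"
  proof eventually_elim
    case (elim x)
    show ?case
    proof (cases "f x = 0")
      case False
      then have "RN_deriv (density M f) (density M g) x = ennreal (g x / f x)"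
        using elim f0[of x] by auto
      then show ?thesis
        using f0[of x] g0[of x] by (simp add: entropy_density_def log_def)
    qed (use elim in simp)
  qed
  have "integrable (density M g) ?E \<longleftrightarrow> integrable M (\<lambda>x. g x * ?E x)"
    using g0 by (subst integrable_density) auto
  also have "\<dots> \<longleftrightarrow> integrable M (\<lambda>x. g x * ln (g x / f x))"
    by (rule integrable_cong_AE[OF _ _ E]) auto
  finally have "integrable (density M g) ?E \<longleftrightarrow> \<dots>" .
  moreover have "KL_divergence (exp 1) (density M f) (density M g) = (\<integral>x. g x * ln (g x / f x) \<partial>M)"
    using f0 g0 ac by (subst KL_density_density) (auto simp: log_def)
  ultimately show ?thesis
    using ac' by (simp add: kl_div_def)
qed

lemma kl_div_density:
  fixes g :: "'a \<Rightarrow> real"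
  assumes "sigma_finite_measure M" "g \<in> borel_measurable M" "\<And>x. 0 \<le> g x"
  shows "kl_div (density M g) M =
     (if integrable M (\<lambda>x. g x * ln (g x)) then ereal (\<integral>x. g x * ln (g x) \<partial>M) else \<infinity>)"
  using kl_div_density_density[of M "\<lambda>_. 1" g] assms by (simp add: density_1)

lemma kl_div_finiteE:
  assumes \<pi>: "prob_space \<pi>" and \<rho>: "prob_space \<rho>" and s: "sets \<rho> = sets \<pi>"
    and fin: "kl_div \<rho> \<pi> \<noteq> \<infinity>"
  obtains r :: "'a \<Rightarrow> real" where "r \<in> borel_measurable \<pi>" "\<forall>x. 0 \<le> r x" "\<rho> = density \<pi> r"
    "integrable \<pi> r" "(\<integral>x. r x \<partial>\<pi>) = 1"
    "integrable \<pi> (\<lambda>x. r x * ln (r x))" "kl_div \<rho> \<pi> = ereal (\<integral>x. r x * ln (r x) \<partial>\<pi>)"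
proof -
  interpret \<pi>: prob_space \<pi> by fact
  interpret \<rho>: prob_space \<rho> by fact
  have ac: "absolutely_continuous \<pi> \<rho>"
    using fin by (auto simp: kl_div_def split: if_splits)
  obtain r where r[measurable]: "r \<in> borel_measurable \<pi>"
    and RN: "AE x in \<pi>. RN_deriv \<pi> \<rho> x = ennreal (r x)" and r0: "\<And>x. 0 \<le> r x"
    using \<pi>.real_RN_deriv[OF \<rho>.finite_measure_axioms ac s] by metis
  have "density \<pi> r = density \<pi> (RN_deriv \<pi> \<rho>)"
    using RN by (intro density_cong) auto
  then have d: "\<rho> = density \<pi> r"
    using \<pi>.density_RN_deriv[OF ac s] by simp
  have "(\<integral>\<^sup>+x. ennreal (r x) \<partial>\<pi>) = emeasure \<rho> (space \<pi>)"
    unfolding d by (subst emeasure_density) (auto intro!: nn_integral_cong)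
  also have "\<dots> = ennreal 1"
    using \<rho>.emeasure_space_1 sets_eq_imp_space_eq[OF s] by simp
  finally have nn: "(\<integral>\<^sup>+x. ennreal (r x) \<partial>\<pi>) = ennreal 1" .
  have i: "integrable \<pi> r"
    by (rule integrableI_nn_integral_finite[OF r _ nn]) (use r0 in auto)
  have i1: "(\<integral>x. r x \<partial>\<pi>) = 1"
    using nn r0 by (subst integral_eq_nn_integral) auto
  note k = kl_div_density[OF \<pi>.sigma_finite_measure_axioms r r0, folded d]
  show thesis
    using fin by (intro that[OF r _ d i i1] allI r0) (auto simp: k split: if_splits)
qed

lemma x_ln_x_ge: "0 \<le> x \<Longrightarrow> x - 1 \<le> x * ln x" for x :: real
  using kl_bregman_nonneg[of x 1] by (simp add: kl_bregman_def)

lemma kl_div_nonneg: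
  assumes "prob_space \<pi>" "prob_space \<rho>" "sets \<rho> = sets \<pi>"
  shows "0 \<le> kl_div \<rho> \<pi>"
proof (cases "kl_div \<rho> \<pi> = \<infinity>")
  case False
  interpret \<pi>: prob_space \<pi> by fact
  obtain r where r: "r \<in> borel_measurable \<pi>" "\<forall>x. 0 \<le> r x" "\<rho> = density \<pi> r"
    "integrable \<pi> r" "(\<integral>x. r x \<partial>\<pi>) = 1"
    "integrable \<pi> (\<lambda>x. r x * ln (r x))" "kl_div \<rho> \<pi> = ereal (\<integral>x. r x * ln (r x) \<partial>\<pi>)"
    by (rule kl_div_finiteE[OF assms False])
  have "(\<integral>x. r x - 1 \<partial>\<pi>) \<le> (\<integral>x. r x * ln (r x) \<partial>\<pi>)"
    using r x_ln_x_ge by (intro integral_mono) auto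
  then show ?thesis
    using r by (simp add: \<pi>.prob_space)
qed simp

lemma mix_density:
  fixes r s :: "'a \<Rightarrow> real"
  assumes [measurable]: "r \<in> borel_measurable M" "s \<in> borel_measurable M"
    and nn: "\<And>x. 0 \<le> r x" "\<And>x. 0 \<le> s x" and e: "0 \<le> e" "e \<le> 1"
  shows "mix e (density M r) (density M s) = density M (\<lambda>x. e * r x + (1 - e) * s x)"
proof (rule measure_eqI)
  fix A assume "A \<in> sets (mix e (density M r) (density M s))"
  then have [measurable]: "A \<in> sets M" by simp
  have "emeasure (mix e (density M r) (density M s)) A =
      ennreal e * (\<integral>\<^sup>+x. ennreal (r x) * indicator A x \<partial>M)
      + ennreal (1 - e) * (\<integral>\<^sup>+x. ennreal (s x) * indicator A x \<partial>M)"
    by (subst emeasure_mix) (auto simp: emeasure_density)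
  also have "\<dots> = (\<integral>\<^sup>+x. ennreal e * (ennreal (r x) * indicator A x)
      + ennreal (1 - e) * (ennreal (s x) * indicator A x) \<partial>M)"
    by (simp add: nn_integral_add nn_integral_cmult)
  also have "\<dots> = (\<integral>\<^sup>+x. ennreal (e * r x + (1 - e) * s x) * indicator A x \<partial>M)"
    using nn e by (intro nn_integral_cong)
      (simp add: ennreal_plus ennreal_mult distrib_right mult.assoc del: ennreal_plus[symmetric])
  also have "\<dots> = emeasure (density M (\<lambda>x. e * r x + (1 - e) * s x)) A"
    by (simp add: emeasure_density)
  finally show "emeasure (mix e (density M r) (density M s)) A = \<dots>" .
qed simp


section \<open>The three-point inequality\<close>

text \<open>
  For a Bregman projection \<open>q\<close> this is the generalised Pythagorean inequality (the case \<open>c = 0\<close>).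
  The growth of the divergence is required along the open segment only, which is all that a comparison
  of the minimiser with the mixtures provides.
\<close>
lemma kl_div_three_point:
  assumes \<pi>: "prob_space \<pi>" and \<rho>: "prob_space \<rho>" and q: "prob_space q"
    and sets: "sets \<rho> = sets \<pi>" "sets q = sets \<pi>"
    and fin: "kl_div \<rho> \<pi> \<noteq> \<infinity>" "kl_div q \<pi> \<noteq> \<infinity>"
    and min: "\<And>e. 0 < e \<Longrightarrow> e < 1 \<Longrightarrow> kl_div q \<pi> + ereal (e * c) \<le> kl_div (mix e \<rho> q) \<pi>"
  shows "kl_div \<rho> q + kl_div q \<pi> + ereal c \<le> kl_div \<rho> \<pi>"
proof -
  interpret \<pi>: prob_space \<pi> by fact
  obtain r :: "'a \<Rightarrow> real" where r[measurable]: "r \<in> borel_measurable \<pi>" and r0': "\<forall>x. 0 \<le> r x"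
    and \<rho>_r: "\<rho> = density \<pi> r" and ir: "integrable \<pi> r" and r1: "(\<integral>x. r x \<partial>\<pi>) = 1"
    and irr: "integrable \<pi> (\<lambda>x. r x * ln (r x))"
    and K: "kl_div \<rho> \<pi> = ereal (\<integral>x. r x * ln (r x) \<partial>\<pi>)"
    by (rule kl_div_finiteE[OF \<pi> \<rho> sets(1) fin(1)])
  obtain s :: "'a \<Rightarrow> real" where s[measurable]: "s \<in> borel_measurable \<pi>" and s0': "\<forall>x. 0 \<le> s x"
    and q_s: "q = density \<pi> s" and ints: "integrable \<pi> s" and s1: "(\<integral>x. s x \<partial>\<pi>) = 1"
    and iss: "integrable \<pi> (\<lambda>x. s x * ln (s x))"
    and S: "kl_div q \<pi> = ereal (\<integral>x. s x * ln (s x) \<partial>\<pi>)"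
    by (rule kl_div_finiteE[OF \<pi> q sets(2) fin(2)])
  have r0: "0 \<le> r x" and s0: "0 \<le> s x" for x
    using r0' s0' by auto
  let ?K = "\<integral>x. r x * ln (r x) \<partial>\<pi>" and ?S = "\<integral>x. s x * ln (s x) \<partial>\<pi>"
  define m where "m e x = e * r x + (1 - e) * s x" for e x
  have [measurable]: "m e \<in> borel_measurable \<pi>" for e
    unfolding m_def by measurable
  have [measurable]: "(\<lambda>x. kl_bregman (f x) (g x)) \<in> borel_measurable \<pi>"
    if [measurable]: "f \<in> borel_measurable \<pi>" "g \<in> borel_measurable \<pi>" for f g
    unfolding kl_bregman_def by measurable
  \<comment> \<open>Estimate for a fixed mixture: the growth hypothesis, divided by \<open>e\<close>. The sign of the right-hand
    side has to be recorded separately, because \<open>ennreal\<close> truncates negative numbers to \<open>0\<close>.\<close>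
  have bound: "(\<integral>\<^sup>+x. ennreal (kl_bregman (r x) (m e x)) \<partial>\<pi>) \<le> ennreal (?K - ?S - c)"
    and bound0: "0 \<le> ?K - ?S - c" if e: "0 < e" "e < 1" for e
  proof -
    have m0: "0 \<le> m e x" for x
      using e r0 s0 by (simp add: m_def)
    have kl0: "0 \<le> kl_bregman (r x) (m e x)" for x
      using e r0[of x] s0[of x] m0[of x]
      by (intro kl_bregman_nonneg) (auto simp: m_def add_nonneg_eq_0_iff)
    have le: "e * kl_bregman (r x) (m e x)
        \<le> e * (r x * ln (r x)) + (1 - e) * (s x * ln (s x)) - m e x * ln (m e x)" for x
      unfolding m_def using r0 s0 e by (intro kl_bregman_mixture_le) auto
    \<comment> \<open>The upper bound is convexity of \<open>x ln x\<close>, the lower bound \<open>-1 \<le> x ln x\<close>.\<close>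
    have im: "integrable \<pi> (\<lambda>x. m e x * ln (m e x))"
    proof (rule Bochner_Integration.integrable_bound)
      show "integrable \<pi> (\<lambda>x. e * \<bar>r x * ln (r x)\<bar> + (1 - e) * \<bar>s x * ln (s x)\<bar> + 1)"
        using irr iss by auto
      show "AE x in \<pi>. norm (m e x * ln (m e x))
          \<le> norm (e * \<bar>r x * ln (r x)\<bar> + (1 - e) * \<bar>s x * ln (s x)\<bar> + 1)"
      proof (rule AE_I2)
        fix x
        have "m e x * ln (m e x) \<le> e * (r x * ln (r x)) + (1 - e) * (s x * ln (s x))"
          using le[of x] kl0[of x] e by (smt (verit) mult_nonneg_nonneg)
        also have "\<dots> \<le> e * \<bar>r x * ln (r x)\<bar> + (1 - e) * \<bar>s x * ln (s x)\<bar>"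
          using e by (intro add_mono mult_left_mono) auto
        finally have "m e x * ln (m e x) \<le> \<dots>" .
        moreover have "- 1 \<le> m e x * ln (m e x)"
          using x_ln_x_ge[OF m0[of x]] m0[of x] by linarith
        moreover have "0 \<le> e * \<bar>r x * ln (r x)\<bar> + (1 - e) * \<bar>s x * ln (s x)\<bar>"
          using e by simp
        ultimately show "norm (m e x * ln (m e x))
            \<le> norm (e * \<bar>r x * ln (r x)\<bar> + (1 - e) * \<bar>s x * ln (s x)\<bar> + 1)"
          by simp
      qed
    qed simp
    have "mix e \<rho> q = density \<pi> (m e)"
      unfolding \<rho>_r q_s m_def using e r0 s0 by (intro mix_density) auto
    then have "kl_div (mix e \<rho> q) \<pi> = ereal (\<integral>x. m e x * ln (m e x) \<partial>\<pi>)"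
      using kl_div_density[OF \<pi>.sigma_finite_measure_axioms _ m0] im by simp
    with min[OF e] have M: "?S + e * c \<le> (\<integral>x. m e x * ln (m e x) \<partial>\<pi>)"
      by (simp add: S)
    \<comment> \<open>The gap between the chord and \<open>x ln x\<close>, which dominates \<open>e\<close> times the divergence integrand.\<close>
    let ?u = "\<lambda>x. e * (r x * ln (r x)) + (1 - e) * (s x * ln (s x)) - m e x * ln (m e x)"
    have u0: "0 \<le> ?u x" for x
      using le[of x] kl0[of x] e by (smt (verit) mult_nonneg_nonneg)
    have iu: "integrable \<pi> ?u"
      using irr iss im by auto
    have "integral\<^sup>L \<pi> ?u = e * ?K + (1 - e) * ?S - (\<integral>x. m e x * ln (m e x) \<partial>\<pi>)"
      using irr iss im by simp
    also have "\<dots> \<le> e * (?K - ?S - c)"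
      using M by (simp add: algebra_simps)
    finally have u: "integral\<^sup>L \<pi> ?u \<le> e * (?K - ?S - c)" .
    moreover have "0 \<le> integral\<^sup>L \<pi> ?u"
      using u0 by (intro Bochner_Integration.integral_nonneg) auto
    ultimately show "0 \<le> ?K - ?S - c"
      using e by (smt (verit) zero_le_mult_iff)
    have "(\<integral>\<^sup>+x. ennreal (kl_bregman (r x) (m e x)) \<partial>\<pi>) \<le> (\<integral>\<^sup>+x. ennreal (?u x / e) \<partial>\<pi>)"
      using le e by (intro nn_integral_mono ennreal_leI) (simp add: pos_le_divide_eq mult.commute)
    also have "\<dots> = ennreal (\<integral>x. ?u x / e \<partial>\<pi>)"
      using iu u0 e by (intro nn_integral_eq_integral integrable_divide AE_I2) auto
    also have "(\<integral>x. ?u x / e \<partial>\<pi>) = integral\<^sup>L \<pi> ?u / e"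
      by (rule integral_divide_zero)
    also have "ennreal (integral\<^sup>L \<pi> ?u / e) \<le> ennreal (?K - ?S - c)"
      using u e by (intro ennreal_leI) (simp add: pos_divide_le_eq mult.commute)
    finally show "(\<integral>\<^sup>+x. ennreal (kl_bregman (r x) (m e x)) \<partial>\<pi>) \<le> ennreal (?K - ?S - c)" .
  qed
  \<comment> \<open>Any sequence in the open unit interval that tends to \<open>0\<close> would do.\<close>
  define e :: "nat \<Rightarrow> real" where "e n = inverse (real (Suc (Suc n)))" for n
  have e: "0 < e n" "e n < 1" for n
    by (auto simp: e_def inverse_less_1_iff)
  have e0: "e \<longlonglongrightarrow> 0"
    unfolding e_def by (rule LIMSEQ_Suc[OF LIMSEQ_inverse_real_of_nat])
  let ?h = "\<lambda>x. if r x \<noteq> 0 \<and> s x = 0 then \<infinity> else ennreal (kl_bregman (r x) (s x))"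
  have lim: "liminf (\<lambda>n. ennreal (kl_bregman (r x) (m (e n) x))) = ?h x" for x
    unfolding m_def
    by (rule lim_imp_Liminf) (use kl_bregman_mixture_tendsto[OF r0 s0 e0 e(1)] in simp_all)
  have "(\<integral>\<^sup>+x. ?h x \<partial>\<pi>) \<le> liminf (\<lambda>n. \<integral>\<^sup>+x. ennreal (kl_bregman (r x) (m (e n) x)) \<partial>\<pi>)"
    unfolding lim[symmetric] by (intro nn_integral_liminf) simp
  also have "\<dots> \<le> ennreal (?K - ?S - c)"
    by (rule Liminf_le) (use bound[OF e] in simp_all)
  finally have h: "(\<integral>\<^sup>+x. ?h x \<partial>\<pi>) \<le> ennreal (?K - ?S - c)" .
  then have "(\<integral>\<^sup>+x. ?h x \<partial>\<pi>) \<noteq> \<infinity>"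
    by (auto simp: top_unique)
  then have "AE x in \<pi>. ?h x \<noteq> \<infinity>"
    by (rule nn_integral_PInf_AE[rotated]) measurable
  then have ac: "AE x in \<pi>. s x = 0 \<longrightarrow> r x = 0"
    by eventually_elim (auto split: if_splits)
  have "(\<integral>\<^sup>+x. ?h x \<partial>\<pi>) = (\<integral>\<^sup>+x. ennreal (kl_bregman (r x) (s x)) \<partial>\<pi>)"
    using ac by (intro nn_integral_cong_AE) auto
  with h have h': "(\<integral>\<^sup>+x. ennreal (kl_bregman (r x) (s x)) \<partial>\<pi>) \<le> ennreal (?K - ?S - c)"
    by simp
  have kl0: "AE x in \<pi>. 0 \<le> kl_bregman (r x) (s x)"
    using ac by eventually_elim (use r0 s0 kl_bregman_nonneg in auto)
  have ikl: "integrable \<pi> (\<lambda>x. kl_bregman (r x) (s x))"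
    using h' by (intro integrableI_nonneg kl0) (auto simp: top_unique less_top[symmetric])
  have "ennreal (\<integral>x. kl_bregman (r x) (s x) \<partial>\<pi>) \<le> ennreal (?K - ?S - c)"
    using h' nn_integral_eq_integral[OF ikl kl0] by simp
  then have D: "(\<integral>x. kl_bregman (r x) (s x) \<partial>\<pi>) \<le> ?K - ?S - c"
    using bound0[of "1/2"] by (simp add: ennreal_le_iff)
  have log: "(\<lambda>x. r x * ln (r x / s x)) = (\<lambda>x. kl_bregman (r x) (s x) - s x + r x)"
    by (simp add: kl_bregman_def)
  have "integrable \<pi> (\<lambda>x. r x * ln (r x / s x))"
    unfolding log using ikl ir ints by auto
  then have "kl_div \<rho> q = ereal (\<integral>x. r x * ln (r x / s x) \<partial>\<pi>)"
    unfolding \<rho>_r q_s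
    using kl_div_density_density[OF \<pi>.sigma_finite_measure_axioms s s0 r r0 ac] by simp
  also have "(\<integral>x. r x * ln (r x / s x) \<partial>\<pi>) = (\<integral>x. kl_bregman (r x) (s x) \<partial>\<pi>)"
    unfolding log using ikl ir ints r1 s1 by simp
  finally show ?thesis
    using D by (simp add: K S)
qed

section \<open>Convexity along mixtures\<close>

lemma nn_integral_mix:
  assumes s: "sets \<mu> = sets \<nu>" and f: "f \<in> borel_measurable \<mu>"
  shows "(\<integral>\<^sup>+x. f x \<partial>mix e \<mu> \<nu>)
    = ennreal e * (\<integral>\<^sup>+x. f x \<partial>\<mu>) + ennreal (1 - e) * (\<integral>\<^sup>+x. f x \<partial>\<nu>)"
  using f
proof induction
  case (cong f g)
  have "(\<integral>\<^sup>+x. f x \<partial>M) = (\<integral>\<^sup>+x. g x \<partial>M)" if "space M = space \<mu>" for M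
    using cong(3) that by (intro nn_integral_cong) auto
  from this[of \<mu>] this[of \<nu>] this[of "mix e \<mu> \<nu>"] show ?case
    using cong(4) sets_eq_imp_space_eq[OF s] by simp
next
  case (set A)
  then show ?case
    using emeasure_mix[OF s set] by (simp add: s)
next
  case (mult u c)
  then have [measurable]: "u \<in> borel_measurable \<nu>" "u \<in> borel_measurable (mix e \<mu> \<nu>)"
    using s by (auto cong: measurable_cong_sets)
  show ?case
    using mult by (simp add: nn_integral_cmult distrib_left mult.left_commute)
next
  case (add u v)
  then have [measurable]: "u \<in> borel_measurable \<nu>" "u \<in> borel_measurable (mix e \<mu> \<nu>)"
      "v \<in> borel_measurable \<nu>" "v \<in> borel_measurable (mix e \<mu> \<nu>)"
    using s by (auto cong: measurable_cong_sets)
  show ?case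
    using add by (simp add: nn_integral_add distrib_left ac_simps)
next
  case (seq U)
  then have [measurable]: "U i \<in> borel_measurable \<nu>" "U i \<in> borel_measurable (mix e \<mu> \<nu>)"
      "U i \<in> borel_measurable \<mu>" for i
    using s by (auto cong: measurable_cong_sets)
  have inc: "incseq (\<lambda>i. c * integral\<^sup>N M (U i))" for c :: ennreal and M
    using \<open>incseq U\<close>
    by (auto simp: incseq_def le_fun_def intro!: nn_integral_mono mult_left_mono)
  show ?case
    using seq.IH nn_integral_monotone_convergence_SUP[OF \<open>incseq U\<close>]
    by (simp add: image_comp SUP_mult_left_ennreal ennreal_SUP_add[OF inc inc])
qed

lemma integrable_mixD:
  fixes f :: "'a \<Rightarrow> real"
  assumes s: "sets \<mu> = sets \<nu>" and e: "0 < e" "e < 1" and f: "integrable (mix e \<mu> \<nu>) f"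
  shows "integrable \<mu> f" "integrable \<nu> f"
    "(\<integral>x. f x \<partial>mix e \<mu> \<nu>) = e * (\<integral>x. f x \<partial>\<mu>) + (1 - e) * (\<integral>x. f x \<partial>\<nu>)"
proof -
  have m[measurable]: "f \<in> borel_measurable \<mu>" "f \<in> borel_measurable \<nu>"
    using borel_measurable_integrable[OF f] by (auto simp: s cong: measurable_cong_sets)
  have nn: "(\<integral>\<^sup>+x. ennreal (g (f x)) \<partial>mix e \<mu> \<nu>)
      = ennreal e * (\<integral>\<^sup>+x. ennreal (g (f x)) \<partial>\<mu>) + ennreal (1 - e) * (\<integral>\<^sup>+x. ennreal (g (f x)) \<partial>\<nu>)"
    if [measurable]: "g \<in> borel_measurable borel" for g :: "real \<Rightarrow> real"
    by (rule nn_integral_mix[OF s]) measurable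
  have "(\<integral>\<^sup>+x. ennreal (norm (f x)) \<partial>mix e \<mu> \<nu>) < \<infinity>"
    using f by (simp add: integrable_iff_bounded)
  then show i: "integrable \<mu> f" "integrable \<nu> f"
    using e by (auto simp: nn integrable_iff_bounded ennreal_mult_less_top)
  have fin: "(\<integral>\<^sup>+x. ennreal (f x) \<partial>\<mu>) < top" "(\<integral>\<^sup>+x. ennreal (f x) \<partial>\<nu>) < top"
      "(\<integral>\<^sup>+x. ennreal (- f x) \<partial>\<mu>) < top" "(\<integral>\<^sup>+x. ennreal (- f x) \<partial>\<nu>) < top"
    using i by (auto simp: real_integrable_def less_top)
  show "(\<integral>x. f x \<partial>mix e \<mu> \<nu>) = e * (\<integral>x. f x \<partial>\<mu>) + (1 - e) * (\<integral>x. f x \<partial>\<nu>)"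
    using fin e nn[of "\<lambda>x. x"] nn[of uminus]
    by (simp add: real_lebesgue_integral_def f i enn2real_plus enn2real_mult ennreal_mult_less_top
        algebra_simps)
qed

text \<open>
  Both end points are compared with the mixture \<open>\<kappa>\<close> through the gradient inequality at \<open>\<kappa>\<close>; in the
  weighted sum the gradient terms cancel, because \<open>\<kappa>\<close> is the barycentre.
\<close>
lemma L2_convex_imp_convex_mix:
  assumes dF: "\<And>\<mu>. regular_for \<Theta> F \<mu> \<Longrightarrow> is_first_variation \<Theta> F \<mu> (dF \<mu>)"
    and conv: "L2_convex_on \<Theta> F dF"
    and \<mu>: "\<mu> \<in> prob_on \<Theta>" and \<nu>: "\<nu> \<in> prob_on \<Theta>" and e: "0 < e" "e < 1"
  shows "F (mix e \<mu> \<nu>) \<le> e * F \<mu> + (1 - e) * F \<nu>"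
proof -
  let ?m = "mix e \<mu> \<nu>"
  have s: "sets \<mu> = sets \<nu>"
    using \<mu> \<nu> by (simp add: space_prob_algebra)
  have m: "?m \<in> prob_on \<Theta>"
    using mix_in_prob_on[OF \<mu> \<nu>] e by simp
  have reg: "regular_for \<Theta> F \<kappa>" if "\<kappa> \<in> prob_on \<Theta>" for \<kappa>
    using that by (simp add: regular_for_def)
  have im: "integrable ?m (dF ?m)"
    using dF[OF reg[OF m]] by (simp add: is_first_variation_def)
  define \<phi> where "\<phi> = dF ?m"
  note i = integrable_mixD[OF s e im, folded \<phi>_def]
  have sub: "F ?m + ((\<integral>x. \<phi> x \<partial>\<kappa>) - (\<integral>x. \<phi> x \<partial>?m)) \<le> F \<kappa>"
    if "\<kappa> \<in> prob_on \<Theta>" "integrable \<kappa> \<phi>" for \<kappa>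
    using conv reg[OF m] reg[OF that(1)] that(2) unfolding L2_convex_on_def \<phi>_def by auto
  have "F ?m = e * (F ?m + ((\<integral>x. \<phi> x \<partial>\<mu>) - (\<integral>x. \<phi> x \<partial>?m)))
      + (1 - e) * (F ?m + ((\<integral>x. \<phi> x \<partial>\<nu>) - (\<integral>x. \<phi> x \<partial>?m)))"
    unfolding i(3) by (simp add: algebra_simps)
  also have "\<dots> \<le> e * F \<mu> + (1 - e) * F \<nu>"
    using sub[OF \<mu> i(1)] sub[OF \<nu> i(2)] e by (intro add_mono mult_left_mono) auto
  finally show ?thesis .
qed


section \<open>The proximal scheme\<close>

text \<open>
  Minimality of \<open>q\<close> against the mixtures with \<open>\<rho>\<close>, together with convexity of \<open>F\<close> along them, is the
  growth condition of the three-point inequality with \<open>c = \<tau> (F q - F \<rho>)\<close>. The nonnegative term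
  \<open>KL(q | \<pi>)\<close> is then discarded.
\<close>
lemma proximal_step:
  assumes \<tau>: "0 < \<tau>" and \<pi>: "\<pi> \<in> prob_on \<Theta>" and \<rho>: "\<rho> \<in> prob_on \<Theta>"
    and conv: "\<And>e. 0 < e \<Longrightarrow> e < 1 \<Longrightarrow> F (mix e \<rho> q) \<le> e * F \<rho> + (1 - e) * F q"
    and q: "is_arg_min (\<lambda>\<mu>. ereal (F \<mu>) + ereal (1 / \<tau>) * kl_div \<mu> \<pi>) (\<lambda>\<mu>. \<mu> \<in> prob_on \<Theta>) q"
    and fin: "kl_div \<rho> \<pi> \<noteq> \<infinity>"
  shows "kl_div \<rho> q + ereal (\<tau> * (F q - F \<rho>)) \<le> kl_div \<rho> \<pi>"
proof -
  have qP: "q \<in> prob_on \<Theta>"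
    using q by (simp add: is_arg_min_def)
  have le: "ereal (F q) + ereal (1 / \<tau>) * kl_div q \<pi> \<le> ereal (F \<mu>) + ereal (1 / \<tau>) * kl_div \<mu> \<pi>"
      if "\<mu> \<in> prob_on \<Theta>" for \<mu>
    using q that by (auto simp: is_arg_min_def not_less)
  have prob: "prob_space \<mu>" "sets \<mu> = sets \<pi>" if "\<mu> \<in> prob_on \<Theta>" for \<mu>
    using that \<pi> by (auto simp: space_prob_algebra)
  have nonneg: "0 \<le> kl_div \<mu> \<pi>" if "\<mu> \<in> prob_on \<Theta>" for \<mu>
    using kl_div_nonneg prob \<pi> that by blast
  \<comment> \<open>The competitor \<open>\<rho>\<close> has a finite objective value.\<close>
  have finq: "kl_div q \<pi> \<noteq> \<infinity>"
    using le[OF \<rho>] fin \<tau> nonneg[OF \<rho>] by (cases "kl_div \<rho> \<pi>") auto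
  have min: "kl_div q \<pi> + ereal (e * (\<tau> * (F q - F \<rho>))) \<le> kl_div (mix e \<rho> q) \<pi>"
    if e: "0 < e" "e < 1" for e
  proof (cases "kl_div (mix e \<rho> q) \<pi> = \<infinity>")
    case False
    have mP: "mix e \<rho> q \<in> prob_on \<Theta>"
      using mix_in_prob_on[OF \<rho> qP] e by simp
    obtain a b where ab: "kl_div q \<pi> = ereal a" "kl_div (mix e \<rho> q) \<pi> = ereal b"
      using False finq nonneg[OF mP] nonneg[OF qP]
      by (cases "kl_div q \<pi>"; cases "kl_div (mix e \<rho> q) \<pi>") auto
    have "F q + a / \<tau> \<le> F (mix e \<rho> q) + b / \<tau>"
      using le[OF mP] by (simp add: ab)
    also have "\<dots> \<le> e * F \<rho> + (1 - e) * F q + b / \<tau>"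
      using conv[OF e] by simp
    finally have "a / \<tau> + e * (F q - F \<rho>) \<le> b / \<tau>"
      by (simp add: algebra_simps)
    then have "\<tau> * (a / \<tau> + e * (F q - F \<rho>)) \<le> \<tau> * (b / \<tau>)"
      using \<tau> by (intro mult_left_mono) auto
    then have "a + e * (\<tau> * (F q - F \<rho>)) \<le> b"
      using \<tau> by (simp add: distrib_left mult.left_commute)
    then show ?thesis by (simp add: ab)
  qed simp
  have "kl_div \<rho> q + kl_div q \<pi> + ereal (\<tau> * (F q - F \<rho>)) \<le> kl_div \<rho> \<pi>"
    by (rule kl_div_three_point[OF prob(1)[OF \<pi>] prob(1)[OF \<rho>] prob(1)[OF qP]
          prob(2)[OF \<rho>] prob(2)[OF qP] fin finq min])
  moreover have "kl_div \<rho> q + 0 \<le> kl_div \<rho> q + kl_div q \<pi>"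
    using nonneg[OF qP] by (intro add_left_mono)
  ultimately show ?thesis
    by (metis add.right_neutral add_right_mono order_trans)
qed

text \<open>
  The telescoped sum is kept on the left together with \<open>KL(\<rho> | \<rho>s n)\<close>, so that the induction also
  carries the finiteness of this divergence, which the next step needs.
\<close>
lemma proximal_sum_le:
  fixes \<rho>s :: "nat \<Rightarrow> 'a::euclidean_space measure"
  assumes \<tau>: "\<And>j. j \<ge> 1 \<Longrightarrow> \<tau> j > 0" and \<rho>0: "\<rho>s 0 \<in> prob_on \<Theta>" and \<rho>: "\<rho> \<in> prob_on \<Theta>"
    and conv: "\<And>\<nu> e. \<nu> \<in> prob_on \<Theta> \<Longrightarrow> 0 < e \<Longrightarrow> e < 1
      \<Longrightarrow> F (mix e \<rho> \<nu>) \<le> e * F \<rho> + (1 - e) * F \<nu>"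
    and step: "\<And>j. j \<ge> 1 \<Longrightarrow>
      is_arg_min (\<lambda>\<mu>. ereal (F \<mu>) + ereal (1 / \<tau> j) * kl_div \<mu> (\<rho>s (j - 1)))
        (\<lambda>\<mu>. \<mu> \<in> prob_on \<Theta>) (\<rho>s j)"
    and fin: "kl_div \<rho> (\<rho>s 0) \<noteq> \<infinity>"
  shows "kl_div \<rho> (\<rho>s n) + ereal (\<Sum>l=1..n. \<tau> l * (F (\<rho>s l) - F \<rho>)) \<le> kl_div \<rho> (\<rho>s 0)"
proof (induction n)
  case 0
  then show ?case by simp
next
  case (Suc n)
  have P: "\<rho>s j \<in> prob_on \<Theta>" for j
    using \<rho>0 step[of j] by (cases "j = 0") (auto simp: is_arg_min_def)
  have fin_n: "kl_div \<rho> (\<rho>s n) \<noteq> \<infinity>"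
    using Suc.IH fin by auto
  have "kl_div \<rho> (\<rho>s (Suc n)) + ereal (\<tau> (Suc n) * (F (\<rho>s (Suc n)) - F \<rho>)) \<le> kl_div \<rho> (\<rho>s n)"
    using \<tau>[of "Suc n"] P \<rho> conv[OF P] step[of "Suc n"] fin_n
    by (intro proximal_step[where \<Theta> = \<Theta>]) auto
  then have "kl_div \<rho> (\<rho>s (Suc n)) + ereal (\<tau> (Suc n) * (F (\<rho>s (Suc n)) - F \<rho>))
      + ereal (\<Sum>l=1..n. \<tau> l * (F (\<rho>s l) - F \<rho>))
      \<le> kl_div \<rho> (\<rho>s n) + ereal (\<Sum>l=1..n. \<tau> l * (F (\<rho>s l) - F \<rho>))"
    by (rule add_right_mono)
  also note Suc.IH
  finally show ?case
    by (simp add: ac_simps flip: plus_ereal.simps(1))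
qed

theorem theorem3:
  fixes \<Theta> :: "'a::euclidean_space set"
    and F :: "'a measure \<Rightarrow> real"
    and dF :: "'a measure \<Rightarrow> 'a \<Rightarrow> real"
    and \<rho>star :: "'a measure"
    and L :: real
    and \<tau> :: "nat \<Rightarrow> real"
    and \<rho>s :: "nat \<Rightarrow> 'a measure"
    and k :: nat
    and \<rho> :: "'a measure"
  assumes "lsc_on \<Theta> F"
    and "\<And>\<mu>. regular_for \<Theta> F \<mu> \<Longrightarrow> is_first_variation \<Theta> F \<mu> (dF \<mu>)"
    and "L2_convex_on \<Theta> F dF"
    and "is_arg_min F (\<lambda>\<mu>. \<mu> \<in> prob_on \<Theta>) \<rho>star"
    and "L > 0"
    and "\<And>\<mu>. \<mu> \<in> prob_on \<Theta> \<Longrightarrow>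
           ereal \<bar>F \<mu> - F \<rho>star\<bar> \<le> ereal L * enn2ereal (W1 \<mu> \<rho>star)"
    and "\<rho>s 0 \<in> prob_dens_on \<Theta>"
    and "\<And>j. j \<ge> 1 \<Longrightarrow> \<tau> j > 0"
    and "\<And>j. j \<ge> 1 \<Longrightarrow>
           is_arg_min (\<lambda>\<mu>. ereal (F \<mu>) + ereal (1 / \<tau> j) * kl_div \<mu> (\<rho>s (j - 1)))
             (\<lambda>\<mu>. \<mu> \<in> prob_on \<Theta>) (\<rho>s j)"
    and "k \<ge> 1"
    and "\<rho> \<in> prob_dens_on \<Theta>"
  shows "ereal ((MIN l\<in>{1..k}. F (\<rho>s l)) - F \<rho>star)
           \<le> kl_div \<rho> (\<rho>s 0) / ereal (\<Sum>l=1..k. \<tau> l) + ereal L * enn2ereal (W1 \<rho> \<rho>star)"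
proof -
  note dF = assms(2) and conv = assms(3) and Lip = assms(6) and \<tau> = assms(8) and step = assms(9)
  have P: "\<rho> \<in> prob_on \<Theta>" "\<rho>s 0 \<in> prob_on \<Theta>"
    using assms(7,11) by (auto simp: prob_dens_on_def)
  let ?K = "kl_div \<rho> (\<rho>s 0)" and ?T = "\<Sum>l=1..k. \<tau> l" and ?m = "MIN l\<in>{1..k}. F (\<rho>s l)"
  have T: "0 < ?T"
    using \<tau> \<open>k \<ge> 1\<close> by (intro sum_pos) auto
  have W: "0 \<le> ereal L * enn2ereal (W1 \<rho> \<rho>star)"
    using \<open>L > 0\<close> by simp
  have prob: "prob_space \<rho>" "prob_space (\<rho>s n)" "sets \<rho> = sets (\<rho>s n)" for n
    using P step[of n] by (cases "n = 0"; auto simp: is_arg_min_def space_prob_algebra)+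
  show ?thesis
  proof (cases "?K = \<infinity>")
    case True
    \<comment> \<open>The bound is infinite.\<close>
    then show ?thesis
      using T W by (cases "ereal L * enn2ereal (W1 \<rho> \<rho>star)") auto
  next
    case False
    have nonneg: "0 \<le> kl_div \<rho> (\<rho>s n)" for n
      using prob by (intro kl_div_nonneg)
    obtain K where K: "?K = ereal K"
      using False nonneg[of 0] by (cases ?K) auto
    have "0 + ereal (\<Sum>l=1..k. \<tau> l * (F (\<rho>s l) - F \<rho>))
        \<le> kl_div \<rho> (\<rho>s k) + ereal (\<Sum>l=1..k. \<tau> l * (F (\<rho>s l) - F \<rho>))"
      by (intro add_right_mono nonneg)
    also have "\<dots> \<le> ?K"
      using \<tau> P step False L2_convex_imp_convex_mix[OF dF conv]
      by (intro proximal_sum_le[where \<Theta> = \<Theta>]) auto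
    finally have sum: "(\<Sum>l=1..k. \<tau> l * (F (\<rho>s l) - F \<rho>)) \<le> K"
      by (simp add: K)
    have "?T * (?m - F \<rho>) = (\<Sum>l=1..k. \<tau> l * (?m - F \<rho>))"
      by (simp add: sum_distrib_right)
    also have "\<dots> \<le> (\<Sum>l=1..k. \<tau> l * (F (\<rho>s l) - F \<rho>))"
      using \<tau> by (intro sum_mono mult_left_mono diff_right_mono Min_le) (auto simp: less_imp_le)
    finally have "?m - F \<rho> \<le> K / ?T"
      using sum T by (simp add: pos_le_divide_eq mult.commute)
    then have "ereal (?m - F \<rho>star) \<le> ereal (K / ?T) + ereal \<bar>F \<rho> - F \<rho>star\<bar>"
      by simp
    also have "\<dots> \<le> ereal (K / ?T) + ereal L * enn2ereal (W1 \<rho> \<rho>star)"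
      by (intro add_left_mono Lip P)
    also have "ereal (K / ?T) = ?K / ereal ?T"
      using T by (simp add: K)
    finally show ?thesis .
  qed
qed

end
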